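(* Let $T>0$ and let $H:[0,T]\to(0,1)$ be Hölder continuous with exponent $\gamma>\sup_{t\in[0,T]}H(t)$. Let $B$ be a standard Brownian motion. Fix $t_0\in[0,T)$ and $x>0$. For $\epsilon>0$ with $t_0+\epsilon\le T$ let $$I_1^{\mathrm{loc}}:=\sqrt{2H(t_0+\epsilon)}\int_{t_0}^{t_0+\epsilon}(t_0+\epsilon-s)^{H(t_0+\epsilon)-1/2}\,dB(s).$$ Then $$\lim_{\epsilon\to0^+}\epsilon^{2H(t_0)}\ln\mathbb{P}\left(I_1^{\mathrm{loc}}\ge x\right)=-\frac{x^2}{2}.$$
   Context: A function $H:[0,T]\to(0,1)$ is Hölder continuous with exponent $\gamma>0$ if there is $C>0$ with $|H(t)-H(s)|\le C|t-s|^\gamma$ for all $t,s\in[0,T]$. The stochastic integral is the Itô integral of a deterministic integrand; $I_1^{\mathrm{loc}}$ depends on $\epsilon$. *)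

theory Defs
  imports "HOL-Probability.Probability"
begin

definition hoelder_on :: "real set \<Rightarrow> (real \<Rightarrow> real) \<Rightarrow> real \<Rightarrow> bool" where
  "hoelder_on S f \<gamma> \<longleftrightarrow> \<gamma> > 0 \<and>
     (\<exists>C>0. \<forall>s\<in>S. \<forall>t\<in>S. \<bar>f t - f s\<bar> \<le> C * \<bar>t - s\<bar> powr \<gamma>)"

(* The time set is [0, \<infinity>); nothing is assumed about B at negative times. *)
locale standard_brownian_motion = prob_space M
  for M :: "'a measure" and B :: "real \<Rightarrow> 'a \<Rightarrow> real" +
  assumes random_variable_B: "\<And>t. 0 \<le> t \<Longrightarrow> random_variable borel (B t)"
    and start_zero: "AE \<omega> in M. B 0 \<omega> = 0"
    and indep_increments:
      "\<And>(n::nat) (t::nat \<Rightarrow> real). 0 \<le> t 0 \<Longrightarrow> (\<And>i. i < n \<Longrightarrow> t i < t (Suc i)) \<Longrightarrow>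
         indep_vars (\<lambda>_. borel) (\<lambda>i \<omega>. B (t (Suc i)) \<omega> - B (t i) \<omega>) {..<n}"
    and normal_increments:
      "\<And>s t. 0 \<le> s \<Longrightarrow> s < t \<Longrightarrow>
         distributed M lborel (\<lambda>\<omega>. B t \<omega> - B s \<omega>) (normal_density 0 (sqrt (t - s)))"
    and continuous_paths: "AE \<omega> in M. continuous_on {0..} (\<lambda>t. B t \<omega>)"

definition is_partition :: "real \<Rightarrow> real \<Rightarrow> nat \<Rightarrow> (nat \<Rightarrow> real) \<Rightarrow> bool" where
  "is_partition a b n t \<longleftrightarrow> t 0 = a \<and> t n = b \<and> (\<forall>i<n. t i < t (Suc i))"

definition step_fun :: "nat \<Rightarrow> (nat \<Rightarrow> real) \<Rightarrow> (nat \<Rightarrow> real) \<Rightarrow> real \<Rightarrow> real" where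
  "step_fun n t c s = (\<Sum>i<n. c i * indicator {t i<..t (Suc i)} s)"

definition step_integral ::
    "(real \<Rightarrow> 'a \<Rightarrow> real) \<Rightarrow> nat \<Rightarrow> (nat \<Rightarrow> real) \<Rightarrow> (nat \<Rightarrow> real) \<Rightarrow> 'a \<Rightarrow> real" where
  "step_integral B n t c \<omega> = (\<Sum>i<n. c i * (B (t (Suc i)) \<omega> - B (t i) \<omega>))"

(* Ito integral of a deterministic integrand over [a, b]: the limit in L2(M) of the
   elementary integrals of step functions that converge to f in L2([a, b]).
   The squared L2 distances are nonnegative integrals with values in [0, \<infinity>], so that
   their convergence to 0 entails that f and X are square-integrable. *)
definition has_ito_integral ::
    "'a measure \<Rightarrow> (real \<Rightarrow> 'a \<Rightarrow> real) \<Rightarrow> real \<Rightarrow> real \<Rightarrow> (real \<Rightarrow> real) \<Rightarrow> ('a \<Rightarrow> real) \<Rightarrow> bool" where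
  "has_ito_integral M B a b f X \<longleftrightarrow>
     set_borel_measurable lborel {a..b} f \<and> X \<in> borel_measurable M \<and>
     (\<exists>N t c. (\<forall>k::nat. is_partition a b (N k) (t k)) \<and>
        (\<lambda>k. \<integral>\<^sup>+s\<in>{a..b}. ennreal ((f s - step_fun (N k) (t k) (c k) s)\<^sup>2) \<partial>lborel) \<longlonglongrightarrow> 0 \<and>
        (\<lambda>k. \<integral>\<^sup>+\<omega>. ennreal ((X \<omega> - step_integral B (N k) (t k) (c k) \<omega>)\<^sup>2) \<partial>M) \<longlonglongrightarrow> 0)"

(* The integral is determined only up to M-null sets; SOME picks one version. *)
definition ito_integral ::
    "'a measure \<Rightarrow> (real \<Rightarrow> 'a \<Rightarrow> real) \<Rightarrow> real \<Rightarrow> real \<Rightarrow> (real \<Rightarrow> real) \<Rightarrow> 'a \<Rightarrow> real" where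
  "ito_integral M B a b f = (SOME X. has_ito_integral M B a b f X)"

(* At s = t0 + \<epsilon> the integrand takes the junk value 0 powr _ = 0; as one point is
   Lebesgue-null, this does not affect the integral. *)
definition I1_loc ::
    "'a measure \<Rightarrow> (real \<Rightarrow> 'a \<Rightarrow> real) \<Rightarrow> (real \<Rightarrow> real) \<Rightarrow> real \<Rightarrow> real \<Rightarrow> 'a \<Rightarrow> real" where
  "I1_loc M B H t0 \<epsilon> \<omega> = sqrt (2 * H (t0 + \<epsilon>)) *
     ito_integral M B t0 (t0 + \<epsilon>) (\<lambda>s. (t0 + \<epsilon> - s) powr (H (t0 + \<epsilon>) - 1/2)) \<omega>"

end

theory Submission
  imports Defs
begin

text \<open>
The integral is a centred Gaussian variable, so the claim is a statement about Gaussian tails.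
With \<open>p = H (t0 + \<epsilon>)\<close>, the Ito isometry gives \<open>I1_loc\<close> the variance
\<open>2 p \<integral>\<^sub>0\<^sup>\<epsilon> u powr (2 p - 1) du = \<epsilon> powr (2 p)\<close>: the normalising factor is chosen to make
this exact. A normal variable with standard deviation \<open>\<sigma>\<close> satisfies
\<open>ln P(X \<ge> x) = - (x + O(\<sigma>))\<^sup>2 / (2 \<sigma>\<^sup>2) + O(1)\<close>. Multiplied by \<open>\<epsilon> powr (2 * H t0)\<close>, this tends to
\<open>- x\<^sup>2 / 2\<close> as soon as \<open>\<epsilon> powr (2 * H t0) / \<sigma>\<^sup>2 = \<epsilon> powr (2 * (H t0 - p))\<close> tends to \<open>1\<close>. That is where
Hoelder continuity enters: \<open>\<bar>H t0 - p\<bar>\<close> is at most of order \<open>\<epsilon> powr \<gamma>\<close>, and \<open>\<epsilon> powr \<gamma> * ln \<epsilon>\<close> tends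
to \<open>0\<close>.

The law of the integral takes two steps. Every Ito integral \<open>X\<close> of a deterministic \<open>f\<close> is normal
(\<open>ito_integral_normal\<close>): the elementary integrals are sums of independent normal increments, so
their characteristic functions are known, and these converge along any sequence that converges in
mean square; Levy's uniqueness theorem identifies the limit. That the integral chosen by \<open>SOME\<close> is
an Ito integral at all needs existence (\<open>has_ito_integral_exists\<close>): left-endpoint step functions on
uniform partitions converge to the power kernel by dominated convergence, the isometry turns this
into a Cauchy sequence of elementary integrals, and mean-square completeness
(\<open>L2_Cauchy_convergent\<close>) supplies the limit.
\<close>

section \<open>Gaussian tails and characteristic functions\<close>

text \<open>
For \<open>z \<ge> x \<ge> 0\<close> we have \<open>z\<^sup>2 \<ge> x\<^sup>2 + (z - x)\<^sup>2\<close>, so beyond \<open>x\<close> the centred density is dominated by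
\<open>exp (- x\<^sup>2 / (2 * \<sigma>\<^sup>2))\<close> times the normal density with mean \<open>x\<close>, whose mass is \<open>1\<close>.
\<close>

lemma (in prob_space) normal_tail_upper:
  assumes X: "distributed M lborel X (normal_density 0 \<sigma>)" and "0 < \<sigma>" "0 \<le> x"
  shows "\<P>(\<omega> in M. x \<le> X \<omega>) \<le> exp (- x\<^sup>2 / (2 * \<sigma>\<^sup>2))"
proof -
  have dens: "normal_density 0 \<sigma> z \<le> exp (- x\<^sup>2 / (2 * \<sigma>\<^sup>2)) * normal_density x \<sigma> z" if "x \<le> z" for z
  proof -
    have "x\<^sup>2 + (z - x)\<^sup>2 \<le> z\<^sup>2"
      using mult_nonneg_nonneg[of x "z - x"] assms(3) that by (simp add: power2_eq_square algebra_simps)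
    then have "- z\<^sup>2 / (2 * \<sigma>\<^sup>2) \<le> - x\<^sup>2 / (2 * \<sigma>\<^sup>2) + - (z - x)\<^sup>2 / (2 * \<sigma>\<^sup>2)"
      unfolding add_divide_distrib[symmetric] by (intro divide_right_mono) auto
    then have "exp (- z\<^sup>2 / (2 * \<sigma>\<^sup>2)) \<le> exp (- x\<^sup>2 / (2 * \<sigma>\<^sup>2)) * exp (- (z - x)\<^sup>2 / (2 * \<sigma>\<^sup>2))"
      by (simp flip: exp_add)
    then show ?thesis
      using assms(2) by (simp add: normal_density_def divide_right_mono)
  qed
  have "emeasure M (X -` {x..} \<inter> space M) = (\<integral>\<^sup>+z. ennreal (normal_density 0 \<sigma> z) * indicator {x..} z \<partial>lborel)"
    using X by (rule distributed_emeasure) simp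
  also have "\<dots> \<le> (\<integral>\<^sup>+z. ennreal (exp (- x\<^sup>2 / (2 * \<sigma>\<^sup>2))) * ennreal (normal_density x \<sigma> z) \<partial>lborel)"
    using dens by (intro nn_integral_mono) (auto simp flip: ennreal_mult split: split_indicator)
  also have "\<dots> = ennreal (exp (- x\<^sup>2 / (2 * \<sigma>\<^sup>2)))"
    using assms(2) by (simp add: nn_integral_cmult nn_integral_eq_integral)
  finally have "measure M (X -` {x..} \<inter> space M) \<le> exp (- x\<^sup>2 / (2 * \<sigma>\<^sup>2))"
    by (simp add: emeasure_eq_measure)
  moreover have "X -` {x..} \<inter> space M = {\<omega> \<in> space M. x \<le> X \<omega>}" by auto
  ultimately show ?thesis by simp
qed

text \<open>
The density is decreasing on \<open>{x..x + \<sigma>}\<close>; the bound is its value at the right end of this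
interval times the length \<open>\<sigma>\<close>. This length cancels the factor \<open>1 / \<sigma>\<close> of the density, so the
error on the logarithmic scale stays bounded as \<open>\<sigma>\<close> tends to \<open>0\<close>.
\<close>

lemma (in prob_space) normal_tail_lower:
  assumes X: "distributed M lborel X (normal_density 0 \<sigma>)" and "0 < \<sigma>" "0 \<le> x"
  shows "exp (- (x + \<sigma>)\<^sup>2 / (2 * \<sigma>\<^sup>2)) / sqrt (2 * pi) \<le> \<P>(\<omega> in M. x \<le> X \<omega>)"
proof -
  define m where "m = exp (- (x + \<sigma>)\<^sup>2 / (2 * \<sigma>\<^sup>2)) / sqrt (2 * pi)"
  have m: "0 \<le> m" unfolding m_def by simp
  have dens: "m / \<sigma> \<le> normal_density 0 \<sigma> z" if "x \<le> z" "z \<le> x + \<sigma>" for z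
  proof -
    have "z\<^sup>2 \<le> (x + \<sigma>)\<^sup>2" using that assms(3) by (intro power_mono) auto
    then have "- (x + \<sigma>)\<^sup>2 / (2 * \<sigma>\<^sup>2) \<le> - z\<^sup>2 / (2 * \<sigma>\<^sup>2)" by (intro divide_right_mono) auto
    then show ?thesis
      using assms(2) by (simp add: m_def normal_density_def real_sqrt_mult divide_right_mono)
  qed
  have "ennreal m = ennreal (m / \<sigma>) * emeasure lborel {x..x + \<sigma>}"
    using assms(2) m by (simp flip: ennreal_mult)
  also have "\<dots> = (\<integral>\<^sup>+z. ennreal (m / \<sigma>) * indicator {x..x + \<sigma>} z \<partial>lborel)"
    by (subst nn_integral_cmult_indicator) auto
  also have "\<dots> \<le> (\<integral>\<^sup>+z. ennreal (normal_density 0 \<sigma> z) * indicator {x..} z \<partial>lborel)"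
    using dens by (intro nn_integral_mono) (auto intro: ennreal_leI split: split_indicator)
  also have "\<dots> = emeasure M (X -` {x..} \<inter> space M)"
    using X by (rule distributed_emeasure[symmetric]) simp
  finally have "m \<le> measure M (X -` {x..} \<inter> space M)"
    using m by (simp add: emeasure_eq_measure)
  moreover have "X -` {x..} \<inter> space M = {\<omega> \<in> space M. x \<le> X \<omega>}" by auto
  ultimately show ?thesis by (simp add: m_def)
qed

lemma (in prob_space) ln_normal_tail_bounds:
  assumes X: "distributed M lborel X (normal_density 0 \<sigma>)" and "0 < \<sigma>" "0 \<le> x"
  shows "ln \<P>(\<omega> in M. x \<le> X \<omega>) \<le> - x\<^sup>2 / (2 * \<sigma>\<^sup>2)"
    and "- (x + \<sigma>)\<^sup>2 / (2 * \<sigma>\<^sup>2) - ln (sqrt (2 * pi)) \<le> ln \<P>(\<omega> in M. x \<le> X \<omega>)"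
proof -
  have "0 < exp (- (x + \<sigma>)\<^sup>2 / (2 * \<sigma>\<^sup>2)) / sqrt (2 * pi)" by simp
  with normal_tail_lower[OF assms] have pos: "0 < \<P>(\<omega> in M. x \<le> X \<omega>)" by linarith
  show "ln \<P>(\<omega> in M. x \<le> X \<omega>) \<le> - x\<^sup>2 / (2 * \<sigma>\<^sup>2)"
    using normal_tail_upper[OF assms] pos by (metis exp_gt_zero ln_exp ln_le_cancel_iff)
  have "ln (exp (- (x + \<sigma>)\<^sup>2 / (2 * \<sigma>\<^sup>2)) / sqrt (2 * pi)) \<le> ln \<P>(\<omega> in M. x \<le> X \<omega>)"
    using normal_tail_lower[OF assms] pos by (subst ln_le_cancel_iff) auto
  then show "- (x + \<sigma>)\<^sup>2 / (2 * \<sigma>\<^sup>2) - ln (sqrt (2 * pi)) \<le> ln \<P>(\<omega> in M. x \<le> X \<omega>)"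
    by (simp add: ln_div)
qed

text \<open>
Substituting \<open>x = \<sigma> * y\<close> reduces this to the standard normal distribution.
\<close>

lemma char_normal_density:
  assumes "\<sigma> > 0"
  shows "char (density lborel (normal_density 0 \<sigma>)) \<theta> = complex_of_real (exp (- (\<theta>\<^sup>2 * \<sigma>\<^sup>2) / 2))"
proof -
  have scale: "\<sigma> * normal_density 0 \<sigma> (\<sigma> * y) = std_normal_density y" for y
    using assms by (simp add: normal_density_def real_sqrt_mult power_mult_distrib)
  have "char (density lborel (normal_density 0 \<sigma>)) \<theta>
      = (LINT x|lborel. normal_density 0 \<sigma> x *\<^sub>R iexp (\<theta> * x))"
    unfolding char_def by (rule integral_density) auto
  also have "\<dots> = \<sigma> *\<^sub>R (LINT y|lborel. normal_density 0 \<sigma> (\<sigma> * y) *\<^sub>R iexp (\<theta> * (\<sigma> * y)))"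
    using lborel_integral_real_affine[of \<sigma> "\<lambda>x. normal_density 0 \<sigma> x *\<^sub>R iexp (\<theta> * x)" 0] assms
    by simp
  also have "\<dots> = (LINT y|lborel. std_normal_density y *\<^sub>R iexp ((\<theta> * \<sigma>) * y))"
    by (subst integral_scaleR_right[symmetric]) (simp add: scale mult.assoc del: of_real_mult)
  also have "\<dots> = char std_normal_distribution (\<theta> * \<sigma>)"
    unfolding char_def by (rule integral_density[symmetric]) auto
  also have "\<dots> = complex_of_real (exp (- (\<theta>\<^sup>2 * \<sigma>\<^sup>2) / 2))"
    by (simp add: char_std_normal_distribution power_mult_distrib)
  finally show ?thesis .
qed

lemma (in prob_space) char_distr_eq_expectation:
  assumes "X \<in> borel_measurable M"
  shows "char (distr M borel X) \<theta> = (LINT \<omega>|M. iexp (\<theta> * X \<omega>))"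
  unfolding char_def using assms by (subst integral_distr) auto

lemma (in prob_space) char_normal_distributed:
  assumes "distributed M lborel X (normal_density 0 \<sigma>)" "\<sigma> > 0"
  shows "char (distr M borel X) \<theta> = complex_of_real (exp (- (\<theta>\<^sup>2 * \<sigma>\<^sup>2) / 2))"
proof -
  have "distr M borel X = distr M lborel X" by (rule distr_cong) auto
  then show ?thesis
    using distributed_distr_eq_density[OF assms(1)] char_normal_density[OF assms(2)] by simp
qed

section \<open>Mean-square convergence\<close>

text \<open>
Completeness of the space of square-integrable functions, by the Riesz-Fischer argument: a
subsequence whose consecutive distances decay geometrically converges almost everywhere, and
Fatou's lemma bounds the distance of its limit from late members of the whole sequence.
\<close>

lemma (in prob_space) L2_Cauchy_convergent:
  fixes Y :: "nat \<Rightarrow> 'a \<Rightarrow> real"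
  assumes Y [measurable]: "\<And>k. Y k \<in> borel_measurable M"
    and Cauchy: "\<And>e. e > 0 \<Longrightarrow>
      \<exists>K. \<forall>k\<ge>K. \<forall>l\<ge>K. (\<integral>\<^sup>+\<omega>. ennreal ((Y k \<omega> - Y l \<omega>)\<^sup>2) \<partial>M) \<le> ennreal e"
  obtains X where "X \<in> borel_measurable M"
    and "(\<lambda>k. \<integral>\<^sup>+\<omega>. ennreal ((X \<omega> - Y k \<omega>)\<^sup>2) \<partial>M) \<longlonglongrightarrow> 0"
proof -
  obtain K where K: "\<And>e k l. e > 0 \<Longrightarrow> k \<ge> K e \<Longrightarrow> l \<ge> K e \<Longrightarrow>
      (\<integral>\<^sup>+\<omega>. ennreal ((Y k \<omega> - Y l \<omega>)\<^sup>2) \<partial>M) \<le> ennreal e"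
    using Cauchy by metis
  \<comment> \<open>Summing makes the index increase, and the successors make it unbounded.\<close>
  define r where "r n = (\<Sum>i\<le>n. Suc (K ((1/4)^i)))" for n
  have r_K: "K ((1/4)^n) \<le> r n" for n
    unfolding r_def using member_le_sum[of n "{..n}" "\<lambda>i. Suc (K ((1/4)^i))"] by simp
  have r_ge: "n \<le> r n" for n
    unfolding r_def by (induction n) auto
  have r_mono: "r n \<le> r (Suc n)" for n
    unfolding r_def by simp
  define d where "d n \<omega> = Y (r (Suc n)) \<omega> - Y (r n) \<omega>" for n \<omega>
  have [measurable]: "d n \<in> borel_measurable M" for n
    unfolding d_def by measurable
  have d2: "(\<integral>\<^sup>+\<omega>. ennreal ((d n \<omega>)\<^sup>2) \<partial>M) \<le> ennreal ((1/4)^n)" for n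
    unfolding d_def by (rule K) (auto intro: r_K order_trans[OF r_K r_mono])
  have d1: "(\<integral>\<^sup>+\<omega>. ennreal \<bar>d n \<omega>\<bar> \<partial>M) \<le> ennreal (2 * (1/2)^n)" for n
  proof -
    \<comment> \<open>On a probability space Young's inequality passes from the second to the first moment.\<close>
    have "\<bar>y\<bar> \<le> (1/2)^n + 2^n * y\<^sup>2" for y :: real
    proof -
      have "0 \<le> (1/2)^n * (1 - 2^n * \<bar>y\<bar>)\<^sup>2" by simp
      also have "\<dots> = (1/2)^n - 2 * \<bar>y\<bar> + 2^n * y\<^sup>2"
        by (simp add: power2_eq_square algebra_simps power_one_over)
      finally show ?thesis by simp
    qed
    then have "(\<integral>\<^sup>+\<omega>. ennreal \<bar>d n \<omega>\<bar> \<partial>M)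
        \<le> (\<integral>\<^sup>+\<omega>. ennreal ((1/2)^n) + ennreal (2^n) * ennreal ((d n \<omega>)\<^sup>2) \<partial>M)"
      by (intro nn_integral_mono) (simp flip: ennreal_mult ennreal_plus)
    also have "\<dots> = ennreal ((1/2)^n) + ennreal (2^n) * (\<integral>\<^sup>+\<omega>. ennreal ((d n \<omega>)\<^sup>2) \<partial>M)"
      by (simp add: nn_integral_add nn_integral_cmult emeasure_space_1)
    also have "\<dots> \<le> ennreal ((1/2)^n) + ennreal (2^n) * ennreal ((1/4)^n)"
      using d2 by (intro add_mono mult_mono) auto
    also have "\<dots> = ennreal (2 * (1/2)^n)"
      by (simp flip: ennreal_mult ennreal_plus power_mult_distrib)
    finally show ?thesis .
  qed
  have "(\<integral>\<^sup>+\<omega>. (\<Sum>n. ennreal \<bar>d n \<omega>\<bar>) \<partial>M) = (\<Sum>n. \<integral>\<^sup>+\<omega>. ennreal \<bar>d n \<omega>\<bar> \<partial>M)"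
    by (rule nn_integral_suminf) measurable
  also have "\<dots> \<le> (\<Sum>n. ennreal (2 * (1/2)^n))"
    by (intro suminf_le d1 summableI)
  also have "\<dots> = ennreal (\<Sum>n. 2 * (1/2)^n)"
    by (intro suminf_ennreal2) (auto intro!: summable_mult summable_geometric)
  also have "\<dots> < \<infinity>" by simp
  finally have "(\<integral>\<^sup>+\<omega>. (\<Sum>n. ennreal \<bar>d n \<omega>\<bar>) \<partial>M) \<noteq> \<infinity>" by simp
  then have "AE \<omega> in M. (\<Sum>n. ennreal \<bar>d n \<omega>\<bar>) \<noteq> \<infinity>"
    by (intro nn_integral_PInf_AE) measurable
  then have conv: "AE \<omega> in M. convergent (\<lambda>n. Y (r n) \<omega>)"
  proof (rule AE_mp, intro AE_I2 impI)
    fix \<omega> assume "(\<Sum>n. ennreal \<bar>d n \<omega>\<bar>) \<noteq> \<infinity>"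
    then have "summable (\<lambda>n. \<bar>d n \<omega>\<bar>)"
      by (intro summable_suminf_not_top) auto
    then have "summable (\<lambda>n. d n \<omega>)"
      by (rule summable_rabs_cancel)
    then have "convergent (\<lambda>n. Y (r 0) \<omega> + (\<Sum>i<n. d i \<omega>))"
      unfolding summable_iff_convergent by (intro convergent_add convergent_const)
    then show "convergent (\<lambda>n. Y (r n) \<omega>)"
      unfolding d_def by (subst (asm) sum_lessThan_telescope) simp
  qed
  define X where "X \<omega> = lim (\<lambda>n. Y (r n) \<omega>)" for \<omega>
  have X [measurable]: "X \<in> borel_measurable M"
    unfolding X_def by measurable
  have lim: "AE \<omega> in M. (\<lambda>n. Y (r n) \<omega>) \<longlonglongrightarrow> X \<omega>"
    using conv unfolding X_def by (auto simp: convergent_LIMSEQ_iff)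
  have bound: "(\<integral>\<^sup>+\<omega>. ennreal ((X \<omega> - Y k \<omega>)\<^sup>2) \<partial>M) \<le> ennreal e" if "e > 0" "k \<ge> K e" for e k
  proof -
    have "(\<integral>\<^sup>+\<omega>. ennreal ((X \<omega> - Y k \<omega>)\<^sup>2) \<partial>M)
        = (\<integral>\<^sup>+\<omega>. liminf (\<lambda>n. ennreal ((Y (r n) \<omega> - Y k \<omega>)\<^sup>2)) \<partial>M)"
    proof (rule nn_integral_cong_AE, use lim in eventually_elim)
      fix \<omega> assume "(\<lambda>n. Y (r n) \<omega>) \<longlonglongrightarrow> X \<omega>"
      then have "(\<lambda>n. ennreal ((Y (r n) \<omega> - Y k \<omega>)\<^sup>2)) \<longlonglongrightarrow> ennreal ((X \<omega> - Y k \<omega>)\<^sup>2)"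
        by (intro tendsto_intros)
      from lim_imp_Liminf[OF _ this]
      show "ennreal ((X \<omega> - Y k \<omega>)\<^sup>2) = liminf (\<lambda>n. ennreal ((Y (r n) \<omega> - Y k \<omega>)\<^sup>2))" by simp
    qed
    also have "\<dots> \<le> liminf (\<lambda>n. \<integral>\<^sup>+\<omega>. ennreal ((Y (r n) \<omega> - Y k \<omega>)\<^sup>2) \<partial>M)"
      by (rule nn_integral_liminf) measurable
    also have "\<dots> \<le> ennreal e"
    proof (rule Liminf_le)
      show "\<forall>\<^sub>F n in sequentially. (\<integral>\<^sup>+\<omega>. ennreal ((Y (r n) \<omega> - Y k \<omega>)\<^sup>2) \<partial>M) \<le> ennreal e"
        using eventually_ge_at_top[of "K e"]
        by eventually_elim (use that r_ge in \<open>auto intro!: K intro: order_trans\<close>)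
    qed simp
    finally show ?thesis .
  qed
  have "(\<lambda>k. \<integral>\<^sup>+\<omega>. ennreal ((X \<omega> - Y k \<omega>)\<^sup>2) \<partial>M) \<longlonglongrightarrow> 0"
  proof (rule tendsto_zero_ennreal)
    fix e :: real assume e: "0 < e"
    show "\<forall>\<^sub>F k in sequentially. (\<integral>\<^sup>+\<omega>. ennreal ((X \<omega> - Y k \<omega>)\<^sup>2) \<partial>M) < ennreal e"
      using eventually_ge_at_top[of "K (e / 2)"]
    proof eventually_elim
      case (elim k)
      then have "(\<integral>\<^sup>+\<omega>. ennreal ((X \<omega> - Y k \<omega>)\<^sup>2) \<partial>M) \<le> ennreal (e / 2)"
        using e by (intro bound) auto
      also have "\<dots> < ennreal e" using e by (intro ennreal_lessI) auto
      finally show ?case .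
    qed
  qed
  with X show thesis by (rule that)
qed

text \<open>
Young's inequality \<open>2 u v \<le> \<delta> u\<^sup>2 + v\<^sup>2 / \<delta>\<close> yields bounds with a free parameter \<open>\<delta>\<close>, whose constant
\<open>K \<delta>\<close> may blow up as \<open>\<delta>\<close> tends to \<open>0\<close>. Fixing \<open>\<delta>\<close> before taking the limit is enough.
\<close>

lemma tendsto_of_Young_bound:
  fixes z :: "'b \<Rightarrow> 'a :: real_normed_vector" and e :: "'b \<Rightarrow> real"
  assumes e: "(e \<longlongrightarrow> 0) F"
    and bound: "\<And>\<delta>. 0 < \<delta> \<Longrightarrow> \<forall>\<^sub>F k in F. norm (z k - l) \<le> \<delta> * C + K \<delta> * e k"
  shows "(z \<longlongrightarrow> l) F"
proof (rule tendstoI)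
  fix r :: real assume r: "0 < r"
  \<comment> \<open>The summand \<open>1\<close> keeps the quotient meaningful when \<open>C = 0\<close>.\<close>
  define \<delta> where "\<delta> = r / (2 * (\<bar>C\<bar> + 1))"
  have \<delta>: "0 < \<delta>" unfolding \<delta>_def using r by (simp add: add_nonneg_pos)
  have "\<delta> * C \<le> \<delta> * \<bar>C\<bar>" using \<delta> by (intro mult_left_mono) auto
  also have "\<dots> < \<delta> * (\<bar>C\<bar> + 1)" using \<delta> by simp
  also have "\<dots> = r / 2" unfolding \<delta>_def by (simp add: field_simps add_nonneg_eq_0_iff)
  finally have C: "\<delta> * C < r / 2" .
  have "((\<lambda>k. K \<delta> * e k) \<longlongrightarrow> 0) F"
    using tendsto_mult_right_zero[OF e] .
  then have "\<forall>\<^sub>F k in F. K \<delta> * e k < r / 2"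
    using r by (intro order_tendstoD) auto
  with bound[OF \<delta>] show "\<forall>\<^sub>F k in F. dist (z k) l < r"
    by eventually_elim (use C in \<open>simp add: dist_norm\<close>)
qed

text \<open>
The nonnegative integral is total, whereas the Bochner integral carries the linear calculus. A
nonnegative integral that tends to \<open>0\<close> is eventually finite, which gives integrability.
\<close>

lemma tendsto_integral_square_0:
  fixes D :: "'b \<Rightarrow> 'a \<Rightarrow> real"
  assumes D [measurable]: "\<And>k. D k \<in> borel_measurable N"
    and lim: "((\<lambda>k. \<integral>\<^sup>+x. ennreal ((D k x)\<^sup>2) \<partial>N) \<longlongrightarrow> 0) F"
  shows "\<forall>\<^sub>F k in F. integrable N (\<lambda>x. (D k x)\<^sup>2)"
    and "((\<lambda>k. LINT x|N. (D k x)\<^sup>2) \<longlongrightarrow> 0) F"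
proof -
  have "\<forall>\<^sub>F k in F. (\<integral>\<^sup>+x. ennreal ((D k x)\<^sup>2) \<partial>N) < 1"
    using lim by (intro order_tendstoD) auto
  then show "\<forall>\<^sub>F k in F. integrable N (\<lambda>x. (D k x)\<^sup>2)"
    by eventually_elim (auto simp: integrable_iff_bounded intro: less_trans)
  have "(LINT x|N. (D k x)\<^sup>2) = enn2real (\<integral>\<^sup>+x. ennreal ((D k x)\<^sup>2) \<partial>N)" for k
    by (intro integral_eq_nn_integral) auto
  moreover have "((\<lambda>k. enn2real (\<integral>\<^sup>+x. ennreal ((D k x)\<^sup>2) \<partial>N)) \<longlongrightarrow> enn2real 0) F"
    using lim by (intro tendsto_enn2real) auto
  ultimately show "((\<lambda>k. LINT x|N. (D k x)\<^sup>2) \<longlongrightarrow> 0) F" by simp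
qed

lemma abs_diff_squares_le:
  fixes f g \<delta> :: real
  assumes "0 < \<delta>"
  shows "\<bar>g\<^sup>2 - f\<^sup>2\<bar> \<le> \<delta> * f\<^sup>2 + (1 + 1 / \<delta>) * (f - g)\<^sup>2"
proof -
  define y where "y = \<bar>f - g\<bar>"
  have "0 \<le> (\<delta> * \<bar>f\<bar> - y)\<^sup>2 / \<delta>" using assms by simp
  also have "\<dots> = \<delta> * f\<^sup>2 - 2 * \<bar>f\<bar> * y + y\<^sup>2 / \<delta>"
    using assms by (simp add: power2_eq_square field_simps)
  finally have young: "2 * \<bar>f\<bar> * y \<le> \<delta> * f\<^sup>2 + y\<^sup>2 / \<delta>" by simp
  have "\<bar>g\<^sup>2 - f\<^sup>2\<bar> = y * \<bar>g + f\<bar>"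
    unfolding y_def by (simp add: power2_eq_square square_diff_square_factored abs_mult abs_minus_commute mult.commute)
  also have "\<dots> \<le> y * (y + 2 * \<bar>f\<bar>)"
    unfolding y_def by (intro mult_left_mono) auto
  also have "\<dots> \<le> \<delta> * f\<^sup>2 + (1 + 1 / \<delta>) * y\<^sup>2"
    using young by (simp add: power2_eq_square algebra_simps)
  finally show ?thesis by (simp add: y_def)
qed

text \<open>
Mean-square convergence implies convergence of the second moments. For elementary integrands this
is the convergence of the variances of their integrals.
\<close>

lemma tendsto_integral_square:
  fixes f :: "'a \<Rightarrow> real" and g :: "'b \<Rightarrow> 'a \<Rightarrow> real"
  assumes f [measurable]: "f \<in> borel_measurable N" and g [measurable]: "\<And>k. g k \<in> borel_measurable N"
    and f2: "integrable N (\<lambda>x. (f x)\<^sup>2)" and g2: "\<And>k. integrable N (\<lambda>x. (g k x)\<^sup>2)"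
    and lim: "((\<lambda>k. \<integral>\<^sup>+x. ennreal ((f x - g k x)\<^sup>2) \<partial>N) \<longlongrightarrow> 0) F"
  shows "((\<lambda>k. LINT x|N. (g k x)\<^sup>2) \<longlongrightarrow> (LINT x|N. (f x)\<^sup>2)) F"
proof (rule tendsto_of_Young_bound)
  note D = tendsto_integral_square_0[of "\<lambda>k x. f x - g k x", OF _ lim]
  show "((\<lambda>k. LINT x|N. (f x - g k x)\<^sup>2) \<longlongrightarrow> 0) F" by (rule D) measurable
  fix \<delta> :: real assume \<delta>: "0 < \<delta>"
  have "\<forall>\<^sub>F k in F. integrable N (\<lambda>x. (f x - g k x)\<^sup>2)" by (rule D) measurable
  then show "\<forall>\<^sub>F k in F. norm ((LINT x|N. (g k x)\<^sup>2) - (LINT x|N. (f x)\<^sup>2))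
      \<le> \<delta> * (LINT x|N. (f x)\<^sup>2) + (1 + 1 / \<delta>) * (LINT x|N. (f x - g k x)\<^sup>2)"
  proof eventually_elim
    case (elim k)
    have "norm ((LINT x|N. (g k x)\<^sup>2) - (LINT x|N. (f x)\<^sup>2)) = norm (LINT x|N. (g k x)\<^sup>2 - (f x)\<^sup>2)"
      using f2 g2 by simp
    also have "\<dots> \<le> (LINT x|N. \<bar>(g k x)\<^sup>2 - (f x)\<^sup>2\<bar>)"
      using integral_norm_bound[of N "\<lambda>x. (g k x)\<^sup>2 - (f x)\<^sup>2"] by simp
    also have "\<dots> \<le> (LINT x|N. \<delta> * (f x)\<^sup>2 + (1 + 1 / \<delta>) * (f x - g k x)\<^sup>2)"
      using f2 g2 elim abs_diff_squares_le[OF \<delta>] by (intro integral_mono) auto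
    also have "\<dots> = \<delta> * (LINT x|N. (f x)\<^sup>2) + (1 + 1 / \<delta>) * (LINT x|N. (f x - g k x)\<^sup>2)"
      using f2 elim by simp
    finally show ?case .
  qed
qed

text \<open>
The map \<open>\<lambda>y. iexp (\<theta> * y)\<close> is Lipschitz with constant \<open>\<bar>\<theta>\<bar>\<close>, and the resulting first absolute
moment of \<open>X - Y k\<close> is controlled by its second moment.
\<close>

lemma (in prob_space) tendsto_char_of_L2:
  assumes X [measurable]: "X \<in> borel_measurable M" and Y [measurable]: "\<And>k. Y k \<in> borel_measurable M"
    and lim: "((\<lambda>k. \<integral>\<^sup>+\<omega>. ennreal ((X \<omega> - Y k \<omega>)\<^sup>2) \<partial>M) \<longlongrightarrow> 0) F"
  shows "((\<lambda>k. char (distr M borel (Y k)) \<theta>) \<longlongrightarrow> char (distr M borel X) \<theta>) F"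
proof (rule tendsto_of_Young_bound)
  note D = tendsto_integral_square_0[of "\<lambda>k x. X x - Y k x", OF _ lim]
  show "((\<lambda>k. LINT \<omega>|M. (X \<omega> - Y k \<omega>)\<^sup>2) \<longlongrightarrow> 0) F" by (rule D) measurable
  fix \<delta> :: real assume \<delta>: "0 < \<delta>"
  have iexp_diff: "cmod (iexp (\<theta> * y) - iexp (\<theta> * x)) \<le> \<delta> * 1 + (\<theta>\<^sup>2 / \<delta>) * (x - y)\<^sup>2" for x y
  proof -
    have "iexp (\<theta> * y) - iexp (\<theta> * x) = iexp (\<theta> * x) * (iexp (\<theta> * (y - x)) - 1)"
      by (simp add: algebra_simps flip: exp_add)
    then have "cmod (iexp (\<theta> * y) - iexp (\<theta> * x)) = cmod (iexp (\<theta> * (y - x)) - 1)"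
      by (simp add: norm_mult)
    also have "\<dots> \<le> \<bar>\<theta> * (y - x)\<bar>"
      using iexp_approx1[of "\<theta> * (y - x)" 0] by simp
    also have "\<dots> \<le> \<delta> + (\<theta> * (y - x))\<^sup>2 / \<delta>"
    proof -
      define w where "w = \<bar>\<theta> * (y - x)\<bar>"
      have "0 \<le> w * \<delta>" using \<delta> by (simp add: w_def)
      then have "w * \<delta> \<le> \<delta>\<^sup>2 + w\<^sup>2"
        using sum_squares_bound[of w \<delta>] by linarith
      then have "w \<le> \<delta> + w\<^sup>2 / \<delta>" using \<delta> by (simp add: field_simps power2_eq_square)
      then show ?thesis by (simp add: w_def)
    qed
    finally show ?thesis by (simp add: power_mult_distrib power2_commute)
  qed
  have "\<forall>\<^sub>F k in F. integrable M (\<lambda>\<omega>. (X \<omega> - Y k \<omega>)\<^sup>2)" by (rule D) measurable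
  then show "\<forall>\<^sub>F k in F. norm (char (distr M borel (Y k)) \<theta> - char (distr M borel X) \<theta>)
      \<le> \<delta> * 1 + (\<theta>\<^sup>2 / \<delta>) * (LINT \<omega>|M. (X \<omega> - Y k \<omega>)\<^sup>2)"
  proof eventually_elim
    case (elim k)
    have int: "integrable M (\<lambda>\<omega>. iexp (\<theta> * Z \<omega>))" if "Z \<in> borel_measurable M" for Z
      using that by (intro integrable_iexp) auto
    have "norm (char (distr M borel (Y k)) \<theta> - char (distr M borel X) \<theta>)
        = norm (LINT \<omega>|M. iexp (\<theta> * Y k \<omega>) - iexp (\<theta> * X \<omega>))"
      using int by (simp add: char_distr_eq_expectation)
    also have "\<dots> \<le> (LINT \<omega>|M. \<delta> * 1 + (\<theta>\<^sup>2 / \<delta>) * (X \<omega> - Y k \<omega>)\<^sup>2)"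
      using int elim iexp_diff
      by (intro order_trans[OF integral_norm_bound] integral_mono integrable_norm
          Bochner_Integration.integrable_diff Bochner_Integration.integrable_add) auto
    also have "\<dots> = \<delta> * 1 + (\<theta>\<^sup>2 / \<delta>) * (LINT \<omega>|M. (X \<omega> - Y k \<omega>)\<^sup>2)"
      using elim by (simp add: prob_space)
    finally show ?case .
  qed
qed

section \<open>Step functions on a partition\<close>

lemma partition_mono:
  assumes "is_partition a b n t" "i \<le> j" "j \<le> n"
  shows "t i \<le> t j"
  using assms(2,3)
proof (induction j rule: dec_induct)
  case (step j)
  then have "t j < t (Suc j)" using assms(1) by (simp add: is_partition_def)
  then show ?case using step by simp
qed simp

lemma partition_ge: "is_partition a b n t \<Longrightarrow> i \<le> n \<Longrightarrow> a \<le> t i"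
  using partition_mono[of a b n t 0 i] by (simp add: is_partition_def)

lemma partition_le: "is_partition a b n t \<Longrightarrow> i \<le> n \<Longrightarrow> t i \<le> b"
  using partition_mono[of a b n t i n] by (simp add: is_partition_def)

lemma partition_disjoint:
  assumes "is_partition a b n t" "i < n" "j < n" "i \<noteq> j"
  shows "{t i<..t (Suc i)} \<inter> {t j<..t (Suc j)} = {}"
proof -
  have "t (Suc i) \<le> t j \<or> t (Suc j) \<le> t i"
    using partition_mono[OF assms(1)] assms(2-4) by (meson Suc_leI less_imp_le linorder_neqE_nat)
  then show ?thesis by auto
qed

lemma partition_covers:
  assumes "is_partition a b n t" "a < s" "s \<le> b"
  obtains i where "i < n" "t i < s" "s \<le> t (Suc i)"
proof -
  define m where "m = (LEAST j. s \<le> t j)"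
  have n: "s \<le> t n" using assms by (simp add: is_partition_def)
  have m: "s \<le> t m" unfolding m_def by (rule LeastI[of _ n]) (rule n)
  have "m \<noteq> 0" using m assms by (auto simp: is_partition_def intro!: Nat.gr0I)
  then obtain i where i: "m = Suc i" by (cases m) auto
  have "m \<le> n" unfolding m_def by (rule Least_le) (rule n)
  moreover have "t i < s" using not_less_Least[of i "\<lambda>j. s \<le> t j"] i by (simp add: m_def)
  ultimately show thesis using i m by (intro that[of i]) auto
qed

lemma step_fun_eq:
  assumes "is_partition a b n t" "i < n" "t i < s" "s \<le> t (Suc i)"
  shows "step_fun n t c s = c i"
proof -
  have "step_fun n t c s = (\<Sum>j<n. if j = i then c i else 0)"
    unfolding step_fun_def
  proof (intro sum.cong refl)
    fix j assume "j \<in> {..<n}"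
    then show "c j * indicator {t j<..t (Suc j)} s = (if j = i then c i else 0)"
      using partition_disjoint[OF assms(1), of j i] assms(2-4) by (auto split: split_indicator)
  qed
  then show ?thesis using assms(2) by simp
qed

lemma step_fun_outside:
  assumes "is_partition a b n t" "s \<notin> {a..b}"
  shows "step_fun n t c s = 0"
proof -
  have "s \<notin> {t i<..t (Suc i)}" if "i < n" for i
    using that assms(2) partition_ge[OF assms(1), of i] partition_le[OF assms(1), of "Suc i"] by auto
  then show ?thesis by (simp add: step_fun_def)
qed

lemma step_fun_measurable [measurable]: "step_fun n t c \<in> borel_measurable borel"
  unfolding step_fun_def by measurable

text \<open>
At each point at most one summand of \<open>step_fun n t c\<close> is nonzero, so the square can be taken
coefficientwise.
\<close>

lemma step_fun_square_integral:
  assumes "is_partition a b n t"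
  shows "has_bochner_integral lborel (\<lambda>s. (step_fun n t c s)\<^sup>2) (\<Sum>i<n. (c i)\<^sup>2 * (t (Suc i) - t i))"
proof -
  have "(step_fun n t c s)\<^sup>2 = (\<Sum>i<n. (c i)\<^sup>2 * indicator {t i<..t (Suc i)} s)" for s
  proof (cases "s \<in> {a<..b}")
    case True
    then obtain i where i: "i < n" "t i < s" "s \<le> t (Suc i)"
      using partition_covers[OF assms] by auto
    then show ?thesis
      using step_fun_eq[OF assms i] step_fun_eq[OF assms i, of "\<lambda>i. (c i)\<^sup>2"]
      by (simp add: step_fun_def)
  next
    case False
    have "s \<notin> {t i<..t (Suc i)}" if "i < n" for i
      using that False partition_ge[OF assms, of i] partition_le[OF assms, of "Suc i"] by auto
    then show ?thesis by (simp add: step_fun_def)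
  qed
  moreover have "has_bochner_integral lborel
      (\<lambda>s. \<Sum>i<n. (c i)\<^sup>2 * indicator {t i<..t (Suc i)} s) (\<Sum>i<n. (c i)\<^sup>2 * (t (Suc i) - t i))"
  proof (intro has_bochner_integral_sum has_bochner_integral_mult_right)
    fix i assume "i \<in> {..<n}"
    then have "t i \<le> t (Suc i)" using partition_mono[OF assms, of i "Suc i"] by auto
    then show "has_bochner_integral lborel (indicator {t i<..t (Suc i)}) (t (Suc i) - t i)"
      using has_bochner_integral_real_indicator[of "{t i<..t (Suc i)}" lborel] by simp
  qed
  ultimately show ?thesis by simp
qed

section \<open>Elementary integrals\<close>

context standard_brownian_motion
begin

lemma increment_square:
  assumes "0 \<le> s" "0 \<le> t"
  shows "has_bochner_integral M (\<lambda>\<omega>. (B t \<omega> - B s \<omega>)\<^sup>2) \<bar>t - s\<bar>"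
proof -
  have *: "has_bochner_integral M (\<lambda>\<omega>. (B t \<omega> - B s \<omega>)\<^sup>2) (t - s)" if "0 \<le> s" "s < t" for s t
  proof -
    have "has_bochner_integral lborel (\<lambda>x. normal_density 0 (sqrt (t - s)) x * x\<^sup>2) (t - s)"
      using normal_moment_even[of "sqrt (t - s)" 0 1] that by (simp add: diff_divide_distrib)
    then show ?thesis
      using distributed_integrable[OF normal_increments[OF that], of "\<lambda>x. x\<^sup>2"]
        distributed_integral[OF normal_increments[OF that], of "\<lambda>x. x\<^sup>2"]
      by (simp add: has_bochner_integral_iff)
  qed
  show ?thesis
    using *[of s t] *[of t s] assms
    by (cases s t rule: linorder_cases) (auto simp: power2_commute has_bochner_integral_zero)
qed

text \<open>
By polarisation the product is a linear combination of four squared increments, so the covariance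
of overlapping increments follows from the variances alone.
\<close>

lemma increment_covariance:
  assumes "0 \<le> s" "s \<le> t" "0 \<le> u" "u \<le> v"
  shows "has_bochner_integral M (\<lambda>\<omega>. (B t \<omega> - B s \<omega>) * (B v \<omega> - B u \<omega>))
    (measure lborel ({s<..t} \<inter> {u<..v}))"
proof -
  have polar: "(p - q) * (y - z) =
      ((p - z)\<^sup>2 + (q - y)\<^sup>2 - (p - y)\<^sup>2 - (q - z)\<^sup>2) / 2" for p q y z :: real
    by (simp add: power2_eq_square algebra_simps)
  have "has_bochner_integral M (\<lambda>\<omega>. (B t \<omega> - B s \<omega>) * (B v \<omega> - B u \<omega>))
      ((\<bar>t - u\<bar> + \<bar>s - v\<bar> - \<bar>t - v\<bar> - \<bar>s - u\<bar>) / 2)"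
    unfolding polar
    by (intro has_bochner_integral_divide has_bochner_integral_diff has_bochner_integral_add
        increment_square) (use assms in auto)
  moreover have "{s<..t} \<inter> {u<..v} = {max s u<..min t v}" by auto
  then have eq: "measure lborel ({s<..t} \<inter> {u<..v}) = (\<bar>t - u\<bar> + \<bar>s - v\<bar> - \<bar>t - v\<bar> - \<bar>s - u\<bar>) / 2"
    using assms by (cases "max s u \<le> min t v") auto
  ultimately show ?thesis by (simp only: eq)
qed

text \<open>
Both second moments expand into the same double sum, because covariances of increments are lengths
of intersections of intervals. The intervals may overlap and the index set is arbitrary, so two
elementary integrals over unrelated partitions can be compared without a common refinement.
\<close>

lemma increment_sum_isometry:
  fixes c :: "'i \<Rightarrow> real" and u v :: "'i \<Rightarrow> real"
  assumes I: "finite I" and uv: "\<And>i. i \<in> I \<Longrightarrow> 0 \<le> u i \<and> u i \<le> v i"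
  defines "V \<equiv> \<Sum>i\<in>I. \<Sum>j\<in>I. c i * c j * measure lborel ({u i<..v i} \<inter> {u j<..v j})"
  shows "has_bochner_integral M (\<lambda>\<omega>. (\<Sum>i\<in>I. c i * (B (v i) \<omega> - B (u i) \<omega>))\<^sup>2) V"
    and "has_bochner_integral lborel (\<lambda>s. (\<Sum>i\<in>I. c i * indicator {u i<..v i} s)\<^sup>2) V"
proof -
  have "has_bochner_integral M (\<lambda>\<omega>. \<Sum>i\<in>I. \<Sum>j\<in>I. c i * c j *
      ((B (v i) \<omega> - B (u i) \<omega>) * (B (v j) \<omega> - B (u j) \<omega>))) V"
    unfolding V_def using uv
    by (intro has_bochner_integral_sum has_bochner_integral_mult_right increment_covariance) auto
  then show "has_bochner_integral M (\<lambda>\<omega>. (\<Sum>i\<in>I. c i * (B (v i) \<omega> - B (u i) \<omega>))\<^sup>2) V"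
    by (simp add: power2_eq_square sum_product mult_ac)
  have "has_bochner_integral lborel (indicator A) (measure lborel A)"
    if "A = {u i<..v i} \<inter> {u j<..v j}" for A and i j
  proof -
    have "A = {max (u i) (u j)<..min (v i) (v j)}" unfolding that by auto
    moreover have "emeasure lborel {p<..q} < \<infinity>" for p q :: real
      by (cases "p \<le> q") auto
    ultimately show ?thesis
      by (intro has_bochner_integral_real_indicator) auto
  qed
  then have "has_bochner_integral lborel (\<lambda>s. \<Sum>i\<in>I. \<Sum>j\<in>I. c i * c j *
      indicator ({u i<..v i} \<inter> {u j<..v j}) s) V"
    unfolding V_def 
    by (intro has_bochner_integral_sum has_bochner_integral_mult_right) auto
  then show "has_bochner_integral lborel (\<lambda>s. (\<Sum>i\<in>I. c i * indicator {u i<..v i} s)\<^sup>2) V"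
    by (simp only: power2_eq_square sum_product indicator_inter_arith mult_ac)
qed

lemma step_integral_measurable:
  assumes "is_partition a b n t" "0 \<le> a"
  shows "step_integral B n t c \<in> borel_measurable M"
proof -
  have "B (t i) \<in> borel_measurable M" if "i \<le> n" for i
    using partition_ge[OF assms(1) that] assms(2) by (intro random_variable_B) simp
  then show ?thesis
    unfolding step_integral_def by (intro borel_measurable_sum borel_measurable_times
        borel_measurable_diff borel_measurable_const) auto
qed

text \<open>
The difference of two elementary integrals is a single sum of weighted increments over the disjoint
union of the two index sets.
\<close>

lemma step_integral_diff_isometry:
  assumes t: "is_partition a b n t" and u: "is_partition a' b' m u" and "0 \<le> a" "0 \<le> a'"
  shows "(\<integral>\<^sup>+\<omega>. ennreal ((step_integral B n t c \<omega> - step_integral B m u d \<omega>)\<^sup>2) \<partial>M)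
    = (\<integral>\<^sup>+s. ennreal ((step_fun n t c s - step_fun m u d s)\<^sup>2) \<partial>lborel)"
proof -
  define I where "I = {..<n} <+> {..<m}"
  define l where "l = case_sum t u"
  define r where "r = case_sum (\<lambda>i. t (Suc i)) (\<lambda>i. u (Suc i))"
  define e where "e = case_sum c (\<lambda>i. - d i)"
  have fin: "finite I" unfolding I_def by simp
  have lr: "0 \<le> l i \<and> l i \<le> r i" if "i \<in> I" for i
  proof -
    have "0 \<le> t i \<and> t i \<le> t (Suc i)" if "i < n" for i
      using that partition_ge[OF t, of i] partition_mono[OF t, of i "Suc i"] assms(3) by auto
    moreover have "0 \<le> u i \<and> u i \<le> u (Suc i)" if "i < m" for i
      using that partition_ge[OF u, of i] partition_mono[OF u, of i "Suc i"] assms(4) by auto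
    ultimately show ?thesis
      using that by (auto simp: I_def l_def r_def)
  qed
  have M: "step_integral B n t c \<omega> - step_integral B m u d \<omega> = (\<Sum>i\<in>I. e i * (B (r i) \<omega> - B (l i) \<omega>))" for \<omega>
    unfolding I_def by (simp add: sum.Plus step_integral_def e_def l_def r_def sum_negf)
  have L: "step_fun n t c s - step_fun m u d s = (\<Sum>i\<in>I. e i * indicator {l i<..r i} s)" for s
    unfolding I_def by (simp add: sum.Plus step_fun_def e_def l_def r_def sum_negf
        del: sum_mult_indicator)
  note iso = increment_sum_isometry[where c = e, OF fin lr]
  show ?thesis
    unfolding M L using iso by (simp add: has_bochner_integral_iff nn_integral_eq_integral)
qed

lemma char_step_integral:
  assumes t: "is_partition a b n t" and "0 \<le> a"
  shows "char (distr M borel (step_integral B n t c)) \<theta>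
    = complex_of_real (exp (- (\<theta>\<^sup>2 * (LINT s|lborel. (step_fun n t c s)\<^sup>2)) / 2))"
proof -
  define D where "D i \<omega> = B (t (Suc i)) \<omega> - B (t i) \<omega>" for i \<omega>
  have lt: "t i < t (Suc i)" "0 \<le> t i" if "i < n" for i
    using t that partition_ge[OF t, of i] assms(2) by (auto simp: is_partition_def)
  have "indep_vars (\<lambda>_. borel) D {..<n}"
    unfolding D_def[abs_def] using t assms(2) by (intro indep_increments) (auto simp: is_partition_def)
  then have "indep_vars (\<lambda>_. borel) (\<lambda>i \<omega>. c i * D i \<omega>) {..<n}"
    by (rule indep_vars_compose2) auto
  then have "char (distr M borel (\<lambda>\<omega>. \<Sum>i<n. c i * D i \<omega>)) \<theta>
      = (\<Prod>i<n. char (distr M borel (\<lambda>\<omega>. c i * D i \<omega>)) \<theta>)"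
    by (rule char_distr_sum)
  also have "\<dots> = (\<Prod>i<n. complex_of_real (exp (- (\<theta>\<^sup>2 * ((c i)\<^sup>2 * (t (Suc i) - t i))) / 2)))"
  proof (intro prod.cong refl)
    fix i assume "i \<in> {..<n}"
    then have i: "i < n" by simp
    have dist: "distributed M lborel (D i) (normal_density 0 (sqrt (t (Suc i) - t i)))"
      unfolding D_def[abs_def] using lt[OF i] by (intro normal_increments)
    have [measurable]: "D i \<in> borel_measurable M"
      using distributed_measurable[OF dist] by simp
    have "char (distr M borel (\<lambda>\<omega>. c i * D i \<omega>)) \<theta> = char (distr M borel (D i)) (\<theta> * c i)"
      by (simp add: char_distr_eq_expectation mult.assoc)
    also have "\<dots> = complex_of_real (exp (- ((\<theta> * c i)\<^sup>2 * (sqrt (t (Suc i) - t i))\<^sup>2) / 2))"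
      using lt[OF i] by (intro char_normal_distributed dist) simp
    finally show "char (distr M borel (\<lambda>\<omega>. c i * D i \<omega>)) \<theta>
        = complex_of_real (exp (- (\<theta>\<^sup>2 * ((c i)\<^sup>2 * (t (Suc i) - t i))) / 2))"
      using lt[OF i] by (simp add: power_mult_distrib mult.assoc)
  qed
  also have "\<dots> = complex_of_real (exp (\<Sum>i<n. - (\<theta>\<^sup>2 * ((c i)\<^sup>2 * (t (Suc i) - t i))) / 2))"
    by (simp add: exp_sum)
  also have "(\<Sum>i<n. - (\<theta>\<^sup>2 * ((c i)\<^sup>2 * (t (Suc i) - t i))) / 2)
      = - (\<theta>\<^sup>2 * (LINT s|lborel. (step_fun n t c s)\<^sup>2)) / 2"
    using step_fun_square_integral[OF t, of c]
    by (simp add: has_bochner_integral_iff sum_distrib_left sum_negf sum_divide_distrib)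
  finally show ?thesis
    by (simp add: step_integral_def[abs_def] D_def)
qed

end

section \<open>Law and existence of the Ito integral\<close>

context standard_brownian_motion
begin

text \<open>
This holds for every version of the integral and every choice of approximating step functions,
which is what makes it applicable to the version selected by \<open>ito_integral\<close>.
\<close>

theorem ito_integral_normal:
  assumes X: "has_ito_integral M B a b f X" and a: "0 \<le> a"
    and v: "has_bochner_integral lborel (\<lambda>s. indicator {a..b} s * (f s)\<^sup>2) v" "0 < v"
  shows "distributed M lborel X (normal_density 0 (sqrt v))"
proof -
  from X obtain N t c where [measurable]: "X \<in> borel_measurable M"
    and f: "set_borel_measurable lborel {a..b} f"
    and t: "\<And>k. is_partition a b (N k) (t k)"
    and f_lim: "(\<lambda>k. \<integral>\<^sup>+s\<in>{a..b}. ennreal ((f s - step_fun (N k) (t k) (c k) s)\<^sup>2) \<partial>lborel) \<longlonglongrightarrow> 0"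
    and X_lim: "(\<lambda>k. \<integral>\<^sup>+\<omega>. ennreal ((X \<omega> - step_integral B (N k) (t k) (c k) \<omega>)\<^sup>2) \<partial>M) \<longlonglongrightarrow> 0"
    unfolding has_ito_integral_def by blast
  define F where "F s = indicator {a..b} s * f s" for s
  define g where "g k = step_fun (N k) (t k) (c k)" for k
  have [measurable]: "F \<in> borel_measurable lborel"
    using f unfolding set_borel_measurable_def F_def[abs_def] by simp
  have [measurable]: "g k \<in> borel_measurable lborel" for k
    unfolding g_def by simp
  have F2: "has_bochner_integral lborel (\<lambda>s. (F s)\<^sup>2) v"
  proof -
    have "(F s)\<^sup>2 = indicator {a..b} s * (f s)\<^sup>2" for s
      by (simp add: F_def split: split_indicator)
    then show ?thesis using v(1) by simp
  qed
  have "(\<integral>\<^sup>+s\<in>{a..b}. ennreal ((f s - g k s)\<^sup>2) \<partial>lborel) = (\<integral>\<^sup>+s. ennreal ((F s - g k s)\<^sup>2) \<partial>lborel)" for k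
    unfolding F_def g_def using step_fun_outside[OF t]
    by (intro nn_integral_cong) (auto split: split_indicator)
  then have "(\<lambda>k. \<integral>\<^sup>+s. ennreal ((F s - g k s)\<^sup>2) \<partial>lborel) \<longlonglongrightarrow> 0"
    using f_lim by (simp add: g_def)
  then have "(\<lambda>k. LINT s|lborel. (g k s)\<^sup>2) \<longlonglongrightarrow> (LINT s|lborel. (F s)\<^sup>2)"
    using F2 step_fun_square_integral[OF t]
    by (intro tendsto_integral_square) (auto simp: has_bochner_integral_iff g_def)
  then have V: "(\<lambda>k. LINT s|lborel. (g k s)\<^sup>2) \<longlonglongrightarrow> v"
    using F2 by (simp add: has_bochner_integral_iff)
  \<comment> \<open>Both sides are limits of the characteristic functions of the elementary integrals.\<close>
  have "char (distr M borel X) \<theta> = char (density lborel (normal_density 0 (sqrt v))) \<theta>" for \<theta>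
  proof (rule LIMSEQ_unique)
    show "(\<lambda>k. char (distr M borel (step_integral B (N k) (t k) (c k))) \<theta>) \<longlonglongrightarrow> char (distr M borel X) \<theta>"
      using X_lim step_integral_measurable[OF t a] by (intro tendsto_char_of_L2) auto
    have "(\<lambda>k. complex_of_real (exp (- (\<theta>\<^sup>2 * (LINT s|lborel. (g k s)\<^sup>2)) / 2)))
        \<longlonglongrightarrow> complex_of_real (exp (- (\<theta>\<^sup>2 * v) / 2))"
      by (intro tendsto_intros V) auto
    then show "(\<lambda>k. char (distr M borel (step_integral B (N k) (t k) (c k))) \<theta>)
        \<longlonglongrightarrow> char (density lborel (normal_density 0 (sqrt v))) \<theta>"
      using v(2) by (simp add: char_step_integral[OF t a] char_normal_density g_def)
  qed
  then have "distr M borel X = density lborel (normal_density 0 (sqrt v))"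
    using v(2) prob_space_normal_density[of "sqrt v" 0]
    by (intro Levy_uniqueness ext)
      (auto simp: real_distribution_def real_distribution_axioms_def intro!: prob_space_distr)
  moreover have "distr M lborel X = distr M borel X" by (rule distr_cong) auto
  ultimately show ?thesis
    unfolding distributed_def by simp
qed

text \<open>
The approximants take the value of \<open>f\<close> at the left end of each cell, so at \<open>s\<close> they only see values
\<open>f u\<close> with \<open>u \<le> s\<close>. A majorant \<open>g\<close> of these values then dominates the approximants as well, even
if \<open>f\<close> has a singularity at \<open>b\<close>.
\<close>

theorem has_ito_integral_exists:
  assumes ab: "0 \<le> a" "a < b"
    and f: "set_borel_measurable lborel {a..b} f"
    and cont: "continuous_on {a..<b} f"
    and g [measurable]: "g \<in> borel_measurable borel"
    and dom: "\<And>s u. a \<le> u \<Longrightarrow> u \<le> s \<Longrightarrow> s < b \<Longrightarrow> \<bar>f u\<bar> \<le> g s"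
    and g2: "(\<integral>\<^sup>+s\<in>{a..b}. ennreal ((g s)\<^sup>2) \<partial>lborel) < \<infinity>"
  shows "\<exists>X. has_ito_integral M B a b f X"
proof -
  define t where "t k i = a + (b - a) * real i / real (Suc k)" for k i
  define c where "c k i = f (t k i)" for k i
  define h where "h k = step_fun (Suc k) (t k) (c k)" for k
  define Y where "Y k = step_integral B (Suc k) (t k) (c k)" for k
  define F where "F s = indicator {a..b} s * f s" for s
  have t: "is_partition a b (Suc k) (t k)" for k
    using ab by (auto simp: is_partition_def t_def divide_strict_right_mono)
  have [measurable]: "F \<in> borel_measurable lborel"
    using f unfolding set_borel_measurable_def F_def[abs_def] by simp
  have [measurable]: "h k \<in> borel_measurable borel" for k
    unfolding h_def by simp
  have Y [measurable]: "Y k \<in> borel_measurable M" for k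
    unfolding Y_def by (rule step_integral_measurable[OF t ab(1)])
  have sample: "\<exists>u. a \<le> u \<and> u < s \<and> s - u \<le> (b - a) / real (Suc k) \<and> h k s = f u"
    if s: "a < s" "s < b" for s k
  proof -
    obtain i where i: "i < Suc k" "t k i < s" "s \<le> t k (Suc i)"
      using partition_covers[OF t, of s k] s by auto
    have "t k (Suc i) - t k i = (b - a) / real (Suc k)"
      unfolding t_def of_nat_Suc[of i] by (simp add: distrib_left add_divide_distrib del: of_nat_Suc)
    then show ?thesis
      using i partition_ge[OF t, of i k] step_fun_eq[OF t i, of "c k"]
      by (intro exI[of _ "t k i"]) (auto simp: h_def c_def)
  qed
  \<comment> \<open>The end points form a null set: no cell contains \<open>a\<close>, and \<open>f\<close> may jump or blow up at \<open>b\<close>.\<close>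
  have AE_inside: "AE s in lborel. a < s \<and> s < b \<or> s \<notin> {a..b}"
    using AE_lborel_singleton[of a] AE_lborel_singleton[of b] by eventually_elim auto
  have "(\<lambda>k. \<integral>\<^sup>+s. ennreal ((F s - h k s)\<^sup>2) \<partial>lborel) \<longlonglongrightarrow> (\<integral>\<^sup>+s. 0 \<partial>(lborel :: real measure))"
  proof (rule nn_integral_dominated_convergence[where w = "\<lambda>s. 4 * (ennreal ((g s)\<^sup>2) * indicator {a..b} s)"])
    show "AE s in lborel. ennreal ((F s - h k s)\<^sup>2) \<le> 4 * (ennreal ((g s)\<^sup>2) * indicator {a..b} s)" for k
      using AE_inside
    proof eventually_elim
      case (elim s)
      show ?case
      proof (cases "s \<in> {a..b}")
        case True
        with elim have s: "a < s" "s < b" by auto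
        obtain u where u: "a \<le> u" "u < s" "h k s = f u" using sample[OF s, of k] by auto
        have "\<bar>f s\<bar> \<le> g s" "\<bar>f u\<bar> \<le> g s" using dom[of s s] dom[of u s] s u by auto
        then have "\<bar>f s - f u\<bar> \<le> \<bar>2 * g s\<bar>" by linarith
        then have "(f s - f u)\<^sup>2 \<le> (2 * g s)\<^sup>2" unfolding abs_le_square_iff .
        then show ?thesis
          using True u by (simp add: F_def power_mult_distrib ennreal_mult' flip: ennreal_numeral)
            (metis ennreal_leI ennreal_mult' zero_le_numeral)
      qed (simp add: F_def h_def step_fun_outside[OF t])
    qed
    show "AE s in lborel. (\<lambda>k. ennreal ((F s - h k s)\<^sup>2)) \<longlonglongrightarrow> 0"
      using AE_inside
    proof eventually_elim
      case (elim s)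
      show ?case
      proof (cases "s \<in> {a..b}")
        case True
        with elim have s: "a < s" "s < b" by auto
        from sample[OF s] obtain u where u: "\<And>k. a \<le> u k" "\<And>k. u k < s"
          "\<And>k. s - u k \<le> (b - a) / real (Suc k)" "\<And>k. h k s = f (u k)" by metis
        have "u \<longlonglongrightarrow> s"
        proof (rule tendsto_sandwich)
          show "\<forall>\<^sub>F k in sequentially. s - (b - a) / real (Suc k) \<le> u k"
            using u(3) by (intro always_eventually allI) (simp add: algebra_simps)
          show "\<forall>\<^sub>F k in sequentially. u k \<le> s"
            using u(2) by (intro always_eventually allI less_imp_le)
          have "(\<lambda>k. s - (b - a) / real (Suc k)) \<longlonglongrightarrow> s - 0"
            by (intro tendsto_intros LIMSEQ_Suc[OF lim_const_over_n])
          then show "(\<lambda>k. s - (b - a) / real (Suc k)) \<longlonglongrightarrow> s" by simp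
        qed (rule tendsto_const)
        then have "(\<lambda>k. f (u k)) \<longlonglongrightarrow> f s"
          by (rule continuous_on_tendsto_compose[OF cont]) (use s u in \<open>auto intro!: always_eventually intro: less_trans\<close>)
        then have "(\<lambda>k. ennreal ((f s - f (u k))\<^sup>2)) \<longlonglongrightarrow> ennreal ((f s - f s)\<^sup>2)"
          by (intro tendsto_intros)
        then show ?thesis using True u(4) by (simp add: F_def)
      qed (simp add: F_def h_def step_fun_outside[OF t])
    qed
    show "(\<integral>\<^sup>+s. 4 * (ennreal ((g s)\<^sup>2) * indicator {a..b} s) \<partial>lborel) < \<infinity>"
      using g2 by (subst nn_integral_cmult) (auto simp: ennreal_mult_less_top)
  qed measurable
  then have h: "(\<lambda>k. \<integral>\<^sup>+s. ennreal ((F s - h k s)\<^sup>2) \<partial>lborel) \<longlonglongrightarrow> 0" by simp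
  have "\<exists>K. \<forall>k\<ge>K. \<forall>l\<ge>K. (\<integral>\<^sup>+\<omega>. ennreal ((Y k \<omega> - Y l \<omega>)\<^sup>2) \<partial>M) \<le> ennreal e" if e: "e > 0" for e
  proof -
    obtain K where K: "\<And>k. k \<ge> K \<Longrightarrow> (\<integral>\<^sup>+s. ennreal ((F s - h k s)\<^sup>2) \<partial>lborel) < ennreal (e / 4)"
      using order_tendstoD(2)[OF h, of "ennreal (e / 4)"] e by (auto simp: eventually_sequentially)
    have "(\<integral>\<^sup>+\<omega>. ennreal ((Y k \<omega> - Y l \<omega>)\<^sup>2) \<partial>M) \<le> ennreal e" if "k \<ge> K" "l \<ge> K" for k l
    proof -
      have sq: "(x - y)\<^sup>2 \<le> 2 * (z - x)\<^sup>2 + 2 * (z - y)\<^sup>2" for x y z :: real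
        using zero_le_power2[of "(z - x) + (z - y)"] by (simp add: power2_eq_square algebra_simps)
      have "(\<integral>\<^sup>+\<omega>. ennreal ((Y k \<omega> - Y l \<omega>)\<^sup>2) \<partial>M) = (\<integral>\<^sup>+s. ennreal ((h k s - h l s)\<^sup>2) \<partial>lborel)"
        unfolding Y_def h_def by (rule step_integral_diff_isometry[OF t t ab(1) ab(1)])
      also have "\<dots> \<le> (\<integral>\<^sup>+s. ennreal 2 * ennreal ((F s - h k s)\<^sup>2) + ennreal 2 * ennreal ((F s - h l s)\<^sup>2) \<partial>lborel)"
        using sq by (intro nn_integral_mono) (simp flip: ennreal_mult ennreal_plus del: ennreal_numeral)
      also have "\<dots> = ennreal 2 * (\<integral>\<^sup>+s. ennreal ((F s - h k s)\<^sup>2) \<partial>lborel)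
          + ennreal 2 * (\<integral>\<^sup>+s. ennreal ((F s - h l s)\<^sup>2) \<partial>lborel)"
        by (simp add: nn_integral_add nn_integral_cmult del: ennreal_numeral)
      also have "\<dots> \<le> ennreal 2 * ennreal (e / 4) + ennreal 2 * ennreal (e / 4)"
        using K that by (intro add_mono mult_left_mono less_imp_le) auto
      also have "\<dots> = ennreal e"
        using e by (simp flip: ennreal_mult ennreal_plus del: ennreal_numeral)
      finally show ?thesis .
    qed
    then show ?thesis by blast
  qed
  from L2_Cauchy_convergent[OF Y this] obtain X where X: "X \<in> borel_measurable M"
    "(\<lambda>k. \<integral>\<^sup>+\<omega>. ennreal ((X \<omega> - Y k \<omega>)\<^sup>2) \<partial>M) \<longlonglongrightarrow> 0" by blast
  have "(\<integral>\<^sup>+s\<in>{a..b}. ennreal ((f s - h k s)\<^sup>2) \<partial>lborel) = (\<integral>\<^sup>+s. ennreal ((F s - h k s)\<^sup>2) \<partial>lborel)" for k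
    unfolding F_def h_def using step_fun_outside[OF t]
    by (intro nn_integral_cong) (auto split: split_indicator)
  then have "(\<lambda>k. \<integral>\<^sup>+s\<in>{a..b}. ennreal ((f s - h k s)\<^sup>2) \<partial>lborel) \<longlonglongrightarrow> 0"
    using h by simp
  then show ?thesis
    using X f t unfolding has_ito_integral_def h_def Y_def
    by (intro exI[of _ X] conjI exI[of _ "\<lambda>k. Suc k"] exI[of _ t] exI[of _ c] allI) auto
qed

corollary ito_integral_distributed:
  assumes "0 \<le> a" "a < b" "set_borel_measurable lborel {a..b} f" "continuous_on {a..<b} f"
    and "g \<in> borel_measurable borel"
    and "\<And>s u. a \<le> u \<Longrightarrow> u \<le> s \<Longrightarrow> s < b \<Longrightarrow> \<bar>f u\<bar> \<le> g s"
    and "(\<integral>\<^sup>+s\<in>{a..b}. ennreal ((g s)\<^sup>2) \<partial>lborel) < \<infinity>"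
    and "has_bochner_integral lborel (\<lambda>s. indicator {a..b} s * (f s)\<^sup>2) v" "0 < v"
  shows "distributed M lborel (ito_integral M B a b f) (normal_density 0 (sqrt v))"
  using ito_integral_normal[OF someI_ex[OF has_ito_integral_exists[OF assms(1-7)]] assms(1,8,9)]
  by (simp add: ito_integral_def)

end

section \<open>The power kernel\<close>

lemma has_bochner_integral_powr_kernel:
  fixes a b q :: real
  assumes "a \<le> b" "-1 < q"
  shows "has_bochner_integral lborel (\<lambda>s. indicator {a..b} s * (b - s) powr q)
    ((b - a) powr (q + 1) / (q + 1))"
proof -
  define c where "c = b - a"
  have c: "0 \<le> c" using assms by (simp add: c_def)
  have nonneg: "0 \<le> c powr (q + 1) / (q + 1)" using assms by simp
  have eq: "(\<lambda>x. indicator {0..c} x * x powr q) = (\<lambda>x. if x \<in> {0..c} then x powr q else 0)"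
    by (auto split: split_indicator)
  have "((\<lambda>x. indicator {0..c} x * x powr q) has_integral (c powr (q + 1) / (q + 1))) UNIV"
    unfolding eq has_integral_restrict_UNIV using assms(2) c by (rule has_integral_powr_from_0)
  then have "(\<integral>\<^sup>+x. ennreal (indicator {0..c} x * x powr q) \<partial>lborel) = ennreal (c powr (q + 1) / (q + 1))"
    by (rule nn_integral_has_integral_lborel[rotated 2]) auto
  then have "has_bochner_integral lborel (\<lambda>x. indicator {0..c} x * x powr q) (c powr (q + 1) / (q + 1))"
    using nonneg by (intro has_bochner_integral_nn_integral) auto
  then have "has_bochner_integral lborel (\<lambda>s. indicator {0..c} (b + - 1 * s) * (b + - 1 * s) powr q)
      (c powr (q + 1) / (q + 1))"
    using lborel_has_bochner_integral_real_affine_iff[of "- 1" "\<lambda>x. indicator {0..c} x * x powr q" _ b]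
    by simp
  moreover have "indicator {0..c} (b + - 1 * s) = (indicator {a..b} s :: real)" for s
    unfolding c_def by (auto split: split_indicator)
  ultimately show ?thesis by (simp add: c_def)
qed

context standard_brownian_motion
begin

text \<open>
For \<open>p < 1/2\<close> the kernel increases to a singularity at \<open>b\<close> and is its own majorant; for \<open>p \<ge> 1/2\<close> it
decreases and is bounded by its value at \<open>a\<close>.
\<close>

lemma ito_integral_powr_kernel_distributed:
  fixes p :: real
  assumes ab: "0 \<le> a" "a < b" and p: "0 < p"
  shows "distributed M lborel (ito_integral M B a b (\<lambda>s. (b - s) powr (p - 1/2)))
    (normal_density 0 (sqrt ((b - a) powr (2 * p) / (2 * p))))"
proof -
  let ?f = "\<lambda>s. (b - s) powr (p - 1/2)"
  define g where "g s = (if p < 1/2 then ?f s else (b - a) powr (p - 1/2))" for s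
  have v: "has_bochner_integral lborel (\<lambda>s. indicator {a..b} s * (?f s)\<^sup>2) ((b - a) powr (2 * p) / (2 * p))"
  proof -
    have "(?f s)\<^sup>2 = (b - s) powr (2 * p - 1)" for s
      by (simp add: power2_eq_square flip: powr_add)
    then show ?thesis
      using has_bochner_integral_powr_kernel[of a b "2 * p - 1"] ab p by simp
  qed
  have f2: "(\<integral>\<^sup>+s\<in>{a..b}. ennreal ((?f s)\<^sup>2) \<partial>lborel) < \<infinity>"
  proof -
    have "(\<integral>\<^sup>+s\<in>{a..b}. ennreal ((?f s)\<^sup>2) \<partial>lborel) = (\<integral>\<^sup>+s. ennreal (indicator {a..b} s * (?f s)\<^sup>2) \<partial>lborel)"
      by (intro nn_integral_cong) (auto split: split_indicator)
    then show ?thesis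
      using v by (simp add: has_bochner_integral_iff nn_integral_eq_integral)
  qed
  have [measurable]: "?f \<in> borel_measurable borel" by measurable
  show ?thesis
  proof (rule ito_integral_distributed[where g = g, OF ab])
    show "set_borel_measurable lborel {a..b} ?f"
      unfolding set_borel_measurable_def by measurable
    show "continuous_on {a..<b} ?f"
      by (intro continuous_intros) auto
    show "g \<in> borel_measurable borel"
      unfolding g_def by measurable
    show "\<bar>?f u\<bar> \<le> g s" if "a \<le> u" "u \<le> s" "s < b" for s u
    proof (cases "p < 1/2")
      case True
      then show ?thesis using that by (simp add: g_def powr_mono2')
    next
      case False
      then show ?thesis using that by (simp add: g_def powr_mono2)
    qed
    show "(\<integral>\<^sup>+s\<in>{a..b}. ennreal ((g s)\<^sup>2) \<partial>lborel) < \<infinity>"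
    proof (cases "p < 1/2")
      case True
      then show ?thesis using f2 by (simp add: g_def)
    next
      case False
      then show ?thesis using ab by (simp add: g_def nn_integral_cmult_indicator ennreal_mult_less_top)
    qed
    show "0 < (b - a) powr (2 * p) / (2 * p)" using ab p by simp
  qed (rule v)
qed

lemma I1_loc_distributed:
  assumes "0 \<le> t0" "0 < \<epsilon>" "0 < H (t0 + \<epsilon>)"
  shows "distributed M lborel (I1_loc M B H t0 \<epsilon>) (normal_density 0 (\<epsilon> powr H (t0 + \<epsilon>)))"
proof -
  define p where "p = H (t0 + \<epsilon>)"
  have p: "0 < p" using assms by (simp add: p_def)
  have "sqrt (2 * p) * sqrt (\<epsilon> powr (2 * p) / (2 * p)) = sqrt ((\<epsilon> powr p)\<^sup>2)"
    using p by (simp add: power2_eq_square flip: real_sqrt_mult powr_add)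
  then have sd: "sqrt (2 * p) * sqrt (\<epsilon> powr (2 * p) / (2 * p)) = \<epsilon> powr p"
    using p by simp
  have "distributed M lborel (ito_integral M B t0 (t0 + \<epsilon>) (\<lambda>s. (t0 + \<epsilon> - s) powr (p - 1/2)))
      (normal_density 0 (sqrt (\<epsilon> powr (2 * p) / (2 * p))))"
    using ito_integral_powr_kernel_distributed[of t0 "t0 + \<epsilon>" p] assms p by simp
  from normal_density_affine[OF this, of "sqrt (2 * p)" 0] show ?thesis
    using p assms(2) by (simp add: sd I1_loc_def[abs_def] flip: p_def)
qed

end

section \<open>The small-time limit\<close>

text \<open>
The logarithm \<open>\<bar>ln \<epsilon>\<bar>\<close> grows at most like \<open>\<epsilon> powr (- \<gamma> / 2)\<close>, which costs only half of the exponent.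
\<close>

lemma tendsto_powr_times_ln_at_right_0:
  fixes \<gamma> :: real
  assumes "0 < \<gamma>"
  shows "((\<lambda>\<epsilon>. \<epsilon> powr \<gamma> * ln \<epsilon>) \<longlongrightarrow> 0) (at_right 0)"
proof (rule Lim_null_comparison)
  have "\<bar>\<epsilon> powr \<gamma> * ln \<epsilon>\<bar> \<le> \<epsilon> powr (\<gamma> / 2) * (2 / \<gamma>)" if "0 < \<epsilon>" "\<epsilon> < 1" for \<epsilon> :: real
  proof -
    have "\<bar>ln \<epsilon>\<bar> = ln (1 / \<epsilon>)" using that by (simp add: ln_div)
    also have "\<dots> \<le> (1 / \<epsilon>) powr (\<gamma> / 2) / (\<gamma> / 2)"
      using that assms by (intro ln_powr_bound) auto
    finally have "\<bar>\<epsilon> powr \<gamma> * ln \<epsilon>\<bar> \<le> \<epsilon> powr \<gamma> * ((1 / \<epsilon>) powr (\<gamma> / 2) / (\<gamma> / 2))"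
      unfolding abs_mult by (intro mult_mono) auto
    also have "\<dots> = \<epsilon> powr (\<gamma> / 2) * \<epsilon> powr (\<gamma> / 2) * ((1 / \<epsilon>) powr (\<gamma> / 2) / (\<gamma> / 2))"
      by (simp flip: powr_add)
    also have "\<dots> = \<epsilon> powr (\<gamma> / 2) * (2 / \<gamma>)"
      using that by (simp add: powr_divide)
    finally show ?thesis .
  qed
  then show "\<forall>\<^sub>F \<epsilon> in at_right 0. norm (\<epsilon> powr \<gamma> * ln \<epsilon>) \<le> \<epsilon> powr (\<gamma> / 2) * (2 / \<gamma>)"
    unfolding eventually_at_right_field by (intro exI[of _ 1]) auto
  have "((\<lambda>\<epsilon>. \<epsilon> powr (\<gamma> / 2) * (2 / \<gamma>)) \<longlongrightarrow> 0 powr (\<gamma> / 2) * (2 / \<gamma>)) (at_right 0)"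
    using assms by (intro tendsto_intros tendsto_powr') (auto simp: eventually_at_filter)
  then show "((\<lambda>\<epsilon>. \<epsilon> powr (\<gamma> / 2) * (2 / \<gamma>)) \<longlongrightarrow> 0) (at_right 0)" by simp
qed

text \<open>
Replacing the exponent \<open>H (t0 + \<epsilon>)\<close> of the variance by \<open>H t0\<close> costs the factor
\<open>exp (2 * (H t0 - H (t0 + \<epsilon>)) * ln \<epsilon>)\<close>. Plain continuity of \<open>H\<close> would not suffice to send it to \<open>1\<close>;
the Hoelder bound beats the logarithm.
\<close>

lemma hoelder_powr_ratio:
  assumes "hoelder_on {0..T} H \<gamma>" "0 \<le> t0" "t0 < T"
  shows "((\<lambda>\<epsilon>. \<epsilon> powr (2 * (H t0 - H (t0 + \<epsilon>)))) \<longlongrightarrow> 1) (at_right 0)"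
proof -
  obtain C where C: "0 < C" "0 < \<gamma>"
    "\<And>s t. s \<in> {0..T} \<Longrightarrow> t \<in> {0..T} \<Longrightarrow> \<bar>H t - H s\<bar> \<le> C * \<bar>t - s\<bar> powr \<gamma>"
    using assms(1) unfolding hoelder_on_def by blast
  have "((\<lambda>\<epsilon>. 2 * (H t0 - H (t0 + \<epsilon>)) * ln \<epsilon>) \<longlongrightarrow> 0) (at_right 0)"
  proof (rule Lim_null_comparison)
    have "\<bar>2 * (H t0 - H (t0 + \<epsilon>)) * ln \<epsilon>\<bar> \<le> 2 * C * \<bar>\<epsilon> powr \<gamma> * ln \<epsilon>\<bar>" if "0 < \<epsilon>" "\<epsilon> < T - t0" for \<epsilon>
    proof -
      have "\<bar>H t0 - H (t0 + \<epsilon>)\<bar> \<le> C * \<epsilon> powr \<gamma>"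
        using C(3)[of "t0 + \<epsilon>" t0] that assms by simp
      then have "2 * \<bar>H t0 - H (t0 + \<epsilon>)\<bar> * \<bar>ln \<epsilon>\<bar> \<le> 2 * (C * \<epsilon> powr \<gamma>) * \<bar>ln \<epsilon>\<bar>"
        by (intro mult_right_mono mult_left_mono) auto
      then show ?thesis by (simp only: abs_mult abs_numeral abs_of_nonneg[OF powr_ge_zero] mult.assoc)
    qed
    then show "\<forall>\<^sub>F \<epsilon> in at_right 0. norm (2 * (H t0 - H (t0 + \<epsilon>)) * ln \<epsilon>) \<le> 2 * C * \<bar>\<epsilon> powr \<gamma> * ln \<epsilon>\<bar>"
      unfolding eventually_at_right_field using assms(3) by (intro exI[of _ "T - t0"]) auto
    show "((\<lambda>\<epsilon>. 2 * C * \<bar>\<epsilon> powr \<gamma> * ln \<epsilon>\<bar>) \<longlongrightarrow> 0) (at_right 0)"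
      using C(2) by (intro tendsto_mult_right_zero tendsto_rabs_zero tendsto_powr_times_ln_at_right_0)
  qed
  from tendsto_exp[OF this]
  have "((\<lambda>\<epsilon>. exp (2 * (H t0 - H (t0 + \<epsilon>)) * ln \<epsilon>)) \<longlongrightarrow> 1) (at_right 0)" by simp
  moreover have "\<forall>\<^sub>F \<epsilon> in at_right 0. exp (2 * (H t0 - H (t0 + \<epsilon>)) * ln \<epsilon>) = \<epsilon> powr (2 * (H t0 - H (t0 + \<epsilon>)))"
    by (auto simp: eventually_at_filter powr_def)
  ultimately show ?thesis
    by (rule Lim_transform_eventually)
qed

theorem theorem4p1:
  fixes M :: "'a measure" and B :: "real \<Rightarrow> 'a \<Rightarrow> real"
    and H :: "real \<Rightarrow> real" and T \<gamma> t0 x :: real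
  assumes "T > 0"
    and "\<forall>t\<in>{0..T}. 0 < H t \<and> H t < 1"
    and "hoelder_on {0..T} H \<gamma>"
    and "\<gamma> > (SUP t\<in>{0..T}. H t)"
    and "standard_brownian_motion M B"
    and "t0 \<in> {0..<T}"
    and "x > 0"
  shows "((\<lambda>\<epsilon>. \<epsilon> powr (2 * H t0) * ln (\<P>(\<omega> in M. I1_loc M B H t0 \<epsilon> \<omega> \<ge> x)))
           \<longlongrightarrow> - (x\<^sup>2 / 2)) (at_right 0)"
proof -
  interpret standard_brownian_motion M B by (rule assms)
  have t0: "0 \<le> t0" "t0 < T" and H0: "0 < H t0" using assms(2,6) by auto
  define q where "q \<epsilon> = \<epsilon> powr (2 * H t0)" for \<epsilon>
  define \<sigma> where "\<sigma> \<epsilon> = \<epsilon> powr H (t0 + \<epsilon>)" for \<epsilon>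
  \<comment> \<open>The mismatch between the scaling factor and the variance.\<close>
  define r where "r \<epsilon> = q \<epsilon> / (\<sigma> \<epsilon>)\<^sup>2" for \<epsilon>
  define L where "L \<epsilon> = ln \<P>(\<omega> in M. x \<le> I1_loc M B H t0 \<epsilon> \<omega>)" for \<epsilon>
  have small: "\<forall>\<^sub>F \<epsilon> in at_right 0. 0 < \<epsilon> \<and> \<epsilon> < T - t0"
    unfolding eventually_at_right_field using t0 by (intro exI[of _ "T - t0"]) auto
  have bounds: "\<forall>\<^sub>F \<epsilon> in at_right 0.
      - (r \<epsilon> * (x + \<sigma> \<epsilon>)\<^sup>2 / 2) - q \<epsilon> * ln (sqrt (2 * pi)) \<le> q \<epsilon> * L \<epsilon> \<and> q \<epsilon> * L \<epsilon> \<le> - (r \<epsilon> * x\<^sup>2 / 2)"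
    using small
  proof eventually_elim
    case (elim \<epsilon>)
    have "0 < H (t0 + \<epsilon>)" using assms(2) t0 elim by auto
    with elim t0 have dist: "distributed M lborel (I1_loc M B H t0 \<epsilon>) (normal_density 0 (\<sigma> \<epsilon>))"
      unfolding \<sigma>_def by (intro I1_loc_distributed) auto
    have \<sigma>: "0 < \<sigma> \<epsilon>" using elim by (simp add: \<sigma>_def)
    have q: "0 \<le> q \<epsilon>" by (simp add: q_def)
    note tail = ln_normal_tail_bounds[OF dist \<sigma>, of x]
    have "q \<epsilon> * L \<epsilon> \<le> q \<epsilon> * (- x\<^sup>2 / (2 * (\<sigma> \<epsilon>)\<^sup>2))"
      unfolding L_def using tail(1) assms(7) q by (intro mult_left_mono) auto
    moreover have "q \<epsilon> * (- (x + \<sigma> \<epsilon>)\<^sup>2 / (2 * (\<sigma> \<epsilon>)\<^sup>2) - ln (sqrt (2 * pi))) \<le> q \<epsilon> * L \<epsilon>"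
      unfolding L_def using tail(2) assms(7) q by (intro mult_left_mono) auto
    ultimately show ?case
      by (simp add: r_def right_diff_distrib mult.commute)
  qed
  have "\<forall>\<^sub>F \<epsilon> in at_right 0. \<epsilon> powr (2 * (H t0 - H (t0 + \<epsilon>))) = r \<epsilon>"
    using small by eventually_elim
      (simp add: r_def q_def \<sigma>_def power2_eq_square flip: powr_add powr_diff)
  then have r: "(r \<longlongrightarrow> 1) (at_right 0)"
    using hoelder_powr_ratio[OF assms(3) t0] by (rule Lim_transform_eventually[rotated])
  have "((\<lambda>\<epsilon>. \<epsilon> powr (2 * H t0)) \<longlongrightarrow> 0 powr (2 * H t0)) (at_right (0::real))"
    using H0 by (intro tendsto_intros tendsto_powr') (auto simp: eventually_at_filter)
  then have q: "(q \<longlongrightarrow> 0) (at_right 0)" by (simp add: q_def[abs_def])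
  \<comment> \<open>By definition \<open>\<sigma>\<^sup>2 = q / r\<close>, where \<open>q\<close> tends to \<open>0\<close> and \<open>r\<close> to \<open>1\<close>.\<close>
  have "((\<lambda>\<epsilon>. sqrt (q \<epsilon> / r \<epsilon>)) \<longlongrightarrow> sqrt (0 / 1)) (at_right 0)"
    by (intro tendsto_intros q r) simp
  moreover have "\<forall>\<^sub>F \<epsilon> in at_right 0. sqrt (q \<epsilon> / r \<epsilon>) = \<sigma> \<epsilon>"
    using small by eventually_elim (simp add: r_def q_def \<sigma>_def)
  ultimately have "(\<sigma> \<longlongrightarrow> sqrt (0 / 1)) (at_right 0)"
    by (rule Lim_transform_eventually)
  then have \<sigma>: "(\<sigma> \<longlongrightarrow> 0) (at_right 0)" by simp
  have "((\<lambda>\<epsilon>. q \<epsilon> * L \<epsilon>) \<longlongrightarrow> - (x\<^sup>2 / 2)) (at_right 0)"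
  proof (rule tendsto_sandwich)
    show "\<forall>\<^sub>F \<epsilon> in at_right 0. - (r \<epsilon> * (x + \<sigma> \<epsilon>)\<^sup>2 / 2) - q \<epsilon> * ln (sqrt (2 * pi)) \<le> q \<epsilon> * L \<epsilon>"
      using bounds by eventually_elim simp
    show "\<forall>\<^sub>F \<epsilon> in at_right 0. q \<epsilon> * L \<epsilon> \<le> - (r \<epsilon> * x\<^sup>2 / 2)"
      using bounds by eventually_elim simp
    have "((\<lambda>\<epsilon>. - (r \<epsilon> * (x + \<sigma> \<epsilon>)\<^sup>2 / 2) - q \<epsilon> * ln (sqrt (2 * pi)))
        \<longlongrightarrow> - (1 * (x + 0)\<^sup>2 / 2) - 0 * ln (sqrt (2 * pi))) (at_right 0)"
      by (intro tendsto_intros r q \<sigma>) auto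
    then show "((\<lambda>\<epsilon>. - (r \<epsilon> * (x + \<sigma> \<epsilon>)\<^sup>2 / 2) - q \<epsilon> * ln (sqrt (2 * pi))) \<longlongrightarrow> - (x\<^sup>2 / 2)) (at_right 0)"
      by simp
    have "((\<lambda>\<epsilon>. - (r \<epsilon> * x\<^sup>2 / 2)) \<longlongrightarrow> - (1 * x\<^sup>2 / 2)) (at_right 0)"
      by (intro tendsto_intros r) auto
    then show "((\<lambda>\<epsilon>. - (r \<epsilon> * x\<^sup>2 / 2)) \<longlongrightarrow> - (x\<^sup>2 / 2)) (at_right 0)" by simp
  qed
  then show ?thesis by (simp add: q_def L_def)
qed

end
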